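(* The expected number of lucky moves in a game of solitaire memory with $2n$ cards, played with the optimal strategy, tends to $\ln 2$ as $n\to\infty$.
   Context: Solitaire memory with $2n$ cards: the deck has $2n$ cards numbered with $1,\dots,n$, each number appearing on exactly two cards (two cards with the same number match and are called mates). The deck is shuffled uniformly at random and the cards are laid face down in a row (so all arrangements of the multiset $\{1,1,2,2,\dots,n,n\}$ are equally likely). A move consists of flipping over first one card and then a second one. If they match, both are removed from play; otherwise both are flipped back face down. The game ends when all pairs have been removed. The player has perfect memory. A card is unknown if it has never been flipped, and known if it has been flipped before. The optimal strategy, which the player is assumed to use, consists of the following move, repeated until the game ends. (1) If the positions of both cards of some pair still in play are known, flip these two cards and remove them. (2) Otherwise, flip over an unknown card; if its mate is known, flip the mate and remove both; if its mate is not known, flip over another unknown card (and remove the two cards if they happen to match). By convention, whenever an unknown card is to be flipped, the leftmost unknown card is chosen. A lucky move is a move in which the player flips two cards that have not been flipped before and they happen to match. The expectation is over the uniformly random arrangement of the deck. *)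

theory Defs
  imports "HOL-Probability.Probability" "HOL-Combinatorics.Multiset_Permutations"
begin

text \<open>A deck is the list of the numbers on the cards, from left to right; cards are
  identified with their positions in this list.\<close>

definition decks :: "nat \<Rightarrow> nat list set" where
  "decks n = permutations_of_multiset (mset_set {1..n} + mset_set {1..n})"

definition mates :: "nat list \<Rightarrow> nat \<Rightarrow> nat \<Rightarrow> bool" where
  "mates d i j \<longleftrightarrow> i \<noteq> j \<and> d ! i = d ! j"

record game =
  in_play :: "nat set"
  flipped :: "nat set"

definition known :: "game \<Rightarrow> nat set" where
  "known S = in_play S \<inter> flipped S"

definition unknown :: "game \<Rightarrow> nat set" where
  "unknown S = in_play S - flipped S"

definition known_pair :: "nat list \<Rightarrow> game \<Rightarrow> bool" where
  "known_pair d S \<longleftrightarrow> (\<exists>i\<in>known S. \<exists>j\<in>known S. mates d i j)"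

text \<open>The strategy looks up the numbers only of known cards and, for the second card, also
  of the first card of the current move. If a pair is known, its mate rule in
  \<open>second_card\<close> completes that pair. Choosing the leftmost known pair is immaterial, as at
  most one pair is ever known at the start of a move.\<close>

definition first_card :: "nat list \<Rightarrow> game \<Rightarrow> nat" where
  "first_card d S =
     (if known_pair d S then Min {i \<in> known S. \<exists>j\<in>known S. mates d i j}
      else Min (unknown S))"

definition second_card :: "nat list \<Rightarrow> game \<Rightarrow> nat" where
  "second_card d S =
     (let i = first_card d S in
      if \<exists>j\<in>known S. mates d i j then THE j. j \<in> known S \<and> mates d i j
      else Min (unknown S - {i}))"

definition move :: "nat list \<Rightarrow> game \<Rightarrow> game" where
  "move d S =
     (let i = first_card d S; j = second_card d S in
      \<lparr>in_play = (if mates d i j then in_play S - {i, j} else in_play S),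
       flipped = flipped S \<union> {i, j}\<rparr>)"

definition lucky :: "nat list \<Rightarrow> game \<Rightarrow> bool" where
  "lucky d S \<longleftrightarrow>
     (let i = first_card d S; j = second_card d S in
      i \<notin> flipped S \<and> j \<notin> flipped S \<and> mates d i j)"

definition start :: "nat list \<Rightarrow> game" where
  "start d = \<lparr>in_play = {..<length d}, flipped = {}\<rparr>"

definition game_after :: "nat list \<Rightarrow> nat \<Rightarrow> game" where
  "game_after d t = (move d ^^ t) (start d)"

text \<open>Every game on a deck from \<open>decks n\<close> ends, so the set of move numbers counted below is
  finite; \<open>move\<close> is meaningless once no card is in play, which the first conjunct excludes.\<close>

definition lucky_moves :: "nat list \<Rightarrow> nat" where
  "lucky_moves d = card {t. in_play (game_after d t) \<noteq> {} \<and> lucky d (game_after d t)}"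

definition expected_lucky_moves :: "nat \<Rightarrow> real" where
  "expected_lucky_moves n =
     measure_pmf.expectation (pmf_of_set (decks n)) (\<lambda>d. real (lucky_moves d))"

end

theory Submission
  imports Defs "HOL-Real_Asymp.Real_Asymp"
begin

text \<open>Unknown cards are flipped from left to right. If a move flips the card at position \<open>p\<close> as
  its first, unknown card, then the next such position is \<open>p + 1\<close> or \<open>p + 2\<close> according to whether
  the mate of \<open>p\<close> lies to its left or to its right, and the move is lucky iff \<open>p\<close> and \<open>p + 1\<close> are
  mates. Unrolling this recursion, whether \<open>p\<close> is such a position is an alternating sum over \<open>j\<close>
  of the events that all of the \<open>j\<close> cards before \<open>p\<close> have their mates further right. The
  probabilities of these events, joint with \<open>p\<close> and \<open>p + 1\<close> being mates, are explicit products.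
  Summing over \<open>p\<close> gives the expectation as \<open>\<Sum>j. (-1) ^ j * w n j\<close> with \<open>w n j\<close> decreasing in \<open>j\<close>
  and tending to \<open>1 / (j + 1)\<close> as \<open>n\<close> grows; Leibniz' bounds for alternating series then allow
  passing to the limit termwise.\<close>

section \<open>Turns, game states and lucky positions\<close>

definition partner :: "nat list \<Rightarrow> nat \<Rightarrow> nat" where
  "partner d i = (THE j. j < length d \<and> mates d i j)"

text \<open>\<open>turn d p\<close> says that the card at position \<open>p\<close> is flipped as the first card of a move:
  its predecessor must not have been flipped as a first card with unknown mate.\<close>

primrec turn :: "nat list \<Rightarrow> nat \<Rightarrow> bool" where
  "turn d 0 \<longleftrightarrow> True"
| "turn d (Suc p) \<longleftrightarrow> \<not> (turn d p \<and> p < partner d p)"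

text \<open>At the start of a move, if the first \<open>p\<close> cards have been flipped, the game is in state
  \<open>clean d p\<close>, unless the previous move turned up as its second card \<open>r = p - 1\<close> the mate of a
  card that was known before: then that pair is still lying there, and the state is
  \<open>pending d r\<close>.\<close>

definition clean :: "nat list \<Rightarrow> nat \<Rightarrow> game" where
  "clean d p = \<lparr>in_play = {i. i < length d \<and> (p \<le> i \<or> p \<le> partner d i)}, flipped = {..<p}\<rparr>"

definition pending :: "nat list \<Rightarrow> nat \<Rightarrow> game" where
  "pending d r = \<lparr>in_play = in_play (clean d (Suc r)) \<union> {r, partner d r}, flipped = {..<Suc r}\<rparr>"

text \<open>For \<open>S = start d\<close> this is the set counted by \<open>lucky_moves\<close>; an
  arbitrary \<open>S\<close> makes induction along the moves possible.\<close>

definition lucky_times :: "nat list \<Rightarrow> game \<Rightarrow> nat set" where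
  "lucky_times d S = {t. in_play ((move d ^^ t) S) \<noteq> {} \<and> lucky d ((move d ^^ t) S)}"

text \<open>The cut-off \<open>p\<close> lets this set shrink in step with the state
  \<open>clean d p\<close>, so that it can be compared with \<open>lucky_times\<close> by
  induction.\<close>

definition lucky_positions :: "nat list \<Rightarrow> nat \<Rightarrow> nat set" where
  "lucky_positions d p = {r. p \<le> r \<and> Suc r < length d \<and> turn d r \<and> mates d r (Suc r)}"

lemma flipped_clean [simp]: "flipped (clean d p) = {..<p}"
  by (simp add: clean_def)

lemma in_play_clean_iff [simp]:
  "i \<in> in_play (clean d p) \<longleftrightarrow> i < length d \<and> (p \<le> i \<or> p \<le> partner d i)"
  by (simp add: clean_def)

lemma clean_fold [simp]: "\<lparr>in_play = in_play (clean d p), flipped = {..<p}\<rparr> = clean d p"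
  by (simp add: clean_def)

lemma flipped_pending [simp]: "flipped (pending d r) = {..<Suc r}"
  by (simp add: pending_def)

lemma in_play_pending [simp]:
  "in_play (pending d r) = in_play (clean d (Suc r)) \<union> {r, partner d r}"
  by (simp add: pending_def)

section \<open>Decks and uniqueness of mates\<close>

lemma decks_iff: "d \<in> decks n \<longleftrightarrow> mset d = mset_set {1..n} + mset_set {1..n}"
  by (simp add: decks_def permutations_of_multiset_def)

lemma length_deck: "d \<in> decks n \<Longrightarrow> length d = 2 * n"
  by (metis decks_iff card_atLeastAtMost diff_Suc_1 mult_2 size_mset size_mset_set size_union)

lemma mates_sym: "mates d i j \<longleftrightarrow> mates d j i"
  by (auto simp: mates_def)

lemma card_same_number:
  assumes "d \<in> decks n" "i < length d"
  shows "card {j. j < length d \<and> d ! j = d ! i} = 2"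
proof -
  have m: "mset d = mset_set {1..n} + mset_set {1..n}"
    using assms(1) by (simp add: decks_iff)
  have "d ! i \<in># mset d" using assms(2) by simp
  then have "d ! i \<in> {1..n}" unfolding m by simp
  then have "count (mset d) (d ! i) = 2" unfolding m by simp
  then have "card {j. j < length d \<and> d ! i = d ! j} = 2"
    by (simp add: count_mset count_list_eq_length_filter length_filter_conv_card)
  moreover have "{j. j < length d \<and> d ! i = d ! j} = {j. j < length d \<and> d ! j = d ! i}" by auto
  ultimately show ?thesis by simp
qed

lemma ex1_mate:
  assumes "d \<in> decks n" "i < length d"
  shows "\<exists>!j. j < length d \<and> mates d i j"
proof -
  let ?A = "{j. j < length d \<and> d ! j = d ! i}"
  have "i \<in> ?A" using assms by simp
  then have "card (?A - {i}) = 1" using card_same_number[OF assms] by simp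
  then obtain j where "?A - {i} = {j}" by (auto simp: card_1_singleton_iff)
  moreover have "?A - {i} = {j. j < length d \<and> mates d i j}" by (auto simp: mates_def)
  ultimately have "{j. j < length d \<and> mates d i j} = {j}" by simp
  then show ?thesis by (metis (no_types, lifting) mem_Collect_eq singleton_iff)
qed

lemma unknown_clean: "unknown (clean d p) = {p..<length d}"
  by (auto simp: unknown_def)

section \<open>Counting lucky moves one move at a time\<close>

lemma lucky_times_step:
  "lucky_times d S = (if in_play S \<noteq> {} \<and> lucky d S then {0} else {}) \<union> Suc ` lucky_times d (move d S)"
proof (rule set_eqI)
  fix t show "t \<in> lucky_times d S \<longleftrightarrow>
    t \<in> (if in_play S \<noteq> {} \<and> lucky d S then {0} else {}) \<union> Suc ` lucky_times d (move d S)"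
    by (cases t) (auto simp: lucky_times_def funpow_swap1)
qed

lemma card_lucky_times_step:
  assumes "finite (lucky_times d (move d S))"
  shows "finite (lucky_times d S)"
    and "card (lucky_times d S) =
      (if in_play S \<noteq> {} \<and> lucky d S then 1 else 0) + card (lucky_times d (move d S))"
proof -
  show "finite (lucky_times d S)"
    using assms by (subst lucky_times_step) auto
  have "{0} \<inter> Suc ` lucky_times d (move d S) = {}" by auto
  then show "card (lucky_times d S) =
      (if in_play S \<noteq> {} \<and> lucky d S then 1 else 0) + card (lucky_times d (move d S))"
    using assms by (subst lucky_times_step) (auto simp: card_image)
qed

lemma lucky_times_finished:
  assumes "in_play S = {}"
  shows "lucky_times d S = {}"
proof -
  have "in_play ((move d ^^ t) S) = {}" for t
    using assms by (induction t) (auto simp: move_def Let_def)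
  then show ?thesis by (simp add: lucky_times_def)
qed

lemma in_play_clean: "p < length d \<Longrightarrow> in_play (clean d p) \<noteq> {}"
  using in_play_clean_iff[of p d p] by blast

lemma finite_lucky_positions: "finite (lucky_positions d p)"
  by (rule finite_subset[of _ "{..<length d}"]) (auto simp: lucky_positions_def)

lemma known_clean: "p \<le> length d \<Longrightarrow> known (clean d p) = {i. i < p \<and> p \<le> partner d i}"
  by (auto simp: known_def)

section \<open>Simulation of the game on a fixed deck\<close>

context
  fixes d n assumes d: "d \<in> decks n"
begin

lemma partner:
  assumes "i < length d"
  shows partner_less: "partner d i < length d" and mates_partner: "mates d i (partner d i)"
  using theI'[OF ex1_mate[OF d assms]] by (auto simp: partner_def)

lemma mates_iff:
  assumes "i < length d" "j < length d"
  shows "mates d i j \<longleftrightarrow> j = partner d i"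
  using ex1_mate[OF d assms(1)] partner[OF assms(1)] assms(2) by blast

lemma partner_partner: "i < length d \<Longrightarrow> partner d (partner d i) = i"
  using mates_iff[of "partner d i" i] partner mates_sym by metis

lemma partner_neq: "i < length d \<Longrightarrow> partner d i \<noteq> i"
  using mates_partner[of i] by (auto simp: mates_def)

lemma partner_eq_iff:
  "i < length d \<Longrightarrow> j < length d \<Longrightarrow> partner d i = j \<longleftrightarrow> i = partner d j"
  using partner_partner by metis

text \<open>Known cards lie before \<open>p\<close> and their mates at or beyond \<open>p\<close>,
  so no known card is the mate of another.\<close>

lemma not_known_pair_clean: "p \<le> length d \<Longrightarrow> \<not> known_pair d (clean d p)"
  by (auto simp: known_pair_def known_clean mates_iff)

lemma first_card_clean: "p < length d \<Longrightarrow> first_card d (clean d p) = p"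
  by (simp add: first_card_def not_known_pair_clean unknown_clean Min_eq_iff)

lemma second_card_clean_known:
  assumes "p < length d" "partner d p < p"
  shows "second_card d (clean d p) = partner d p"
proof -
  have *: "j \<in> known (clean d p) \<and> mates d p j \<longleftrightarrow> j = partner d p" for j
    using assms by (auto simp: known_clean mates_iff partner_partner)
  then have "\<exists>j\<in>known (clean d p). mates d p j" by blast
  then show ?thesis
    by (simp add: second_card_def first_card_clean assms *)
qed

lemma second_card_clean_unknown:
  assumes "p < length d" "p < partner d p"
  shows "second_card d (clean d p) = Suc p"
proof -
  have "\<not> (\<exists>j\<in>known (clean d p). mates d p j)"
    using assms by (auto simp: known_clean mates_iff)
  moreover have "{p..<length d} - {p} = {Suc p..<length d}" by auto
  moreover have "Suc p < length d" using assms partner_less[of p] by simp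
  ultimately show ?thesis
    by (simp add: second_card_def first_card_clean assms unknown_clean Min_eq_iff)
qed

lemma move_clean_known:
  assumes "p < length d" "partner d p < p"
  shows "move d (clean d p) = clean d (Suc p)" "\<not> lucky d (clean d p)"
proof -
  have "in_play (clean d p) - {p, partner d p} = in_play (clean d (Suc p))"
  proof (intro set_eqI)
    fix i show "i \<in> in_play (clean d p) - {p, partner d p} \<longleftrightarrow> i \<in> in_play (clean d (Suc p))"
      using assms partner_eq_iff[of i p] partner_partner[of p]
      by (cases "i < length d") (auto simp: Suc_le_eq le_less)
  qed
  moreover have "{..<p} \<union> {p, partner d p} = {..<Suc p}" using assms by auto
  ultimately show "move d (clean d p) = clean d (Suc p)"
    by (simp add: move_def first_card_clean second_card_clean_known assms mates_partner Let_def
        del: Un_insert_right)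
  show "\<not> lucky d (clean d p)"
    using assms by (simp add: lucky_def first_card_clean second_card_clean_known Let_def)
qed

lemma lucky_clean_iff:
  assumes "p < length d" "p < partner d p"
  shows "lucky d (clean d p) \<longleftrightarrow> mates d p (Suc p)"
  using assms by (simp add: lucky_def first_card_clean second_card_clean_unknown Let_def)

lemma move_clean_unknown:
  assumes "p < length d" "p < partner d p"
  shows "move d (clean d p) =
    (if partner d (Suc p) < p then pending d (Suc p) else clean d (Suc (Suc p)))"
proof -
  have l: "Suc p < length d" using assms partner_less[of p] by simp
  have m: "mates d p (Suc p) \<longleftrightarrow> partner d p = Suc p" using mates_iff[of p "Suc p"] l assms by auto
  have ff: "{..<p} \<union> {p, Suc p} = {..<Suc (Suc p)}" by auto
  have mv: "move d (clean d p) = \<lparr>in_play = (if partner d p = Suc p then in_play (clean d p) - {p, Suc p}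
     else in_play (clean d p)), flipped = {..<Suc (Suc p)}\<rparr>"
    using assms ff
    by (simp add: move_def first_card_clean second_card_clean_unknown Let_def m)
  \<comment> \<open>The second card \<open>Suc p\<close> is the mate of the first (a), the mate of
    an older known card, which leaves a pair pending (b), or a card with a later mate, like the
    first (c).\<close>
  consider (a) "partner d p = Suc p" | (b) "partner d p > Suc p" "partner d (Suc p) < p"
    | (c) "partner d p > Suc p" "partner d (Suc p) > Suc p"
    using assms partner_neq[OF l] partner_eq_iff[of p "Suc p"] l by (metis Suc_lessI not_less_iff_gr_or_eq not_less_eq)
  then show ?thesis
  proof cases
    case a
    then have pp: "partner d (Suc p) = p" using partner_eq_iff[of p "Suc p"] assms l by auto
    have "in_play (clean d p) - {p, Suc p} = in_play (clean d (Suc (Suc p)))" (is "?A = ?B")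
    proof (rule set_eqI)
      fix i show "i \<in> ?A \<longleftrightarrow> i \<in> ?B"
        using a pp partner_eq_iff[of i p] partner_eq_iff[of i "Suc p"] l assms
        by (cases "i < length d"; cases "i = p"; cases "i = Suc p") auto
    qed
    then show ?thesis using a pp mv by simp
  next
    case b
    have "in_play (clean d p) = in_play (clean d (Suc (Suc p))) \<union> {Suc p, partner d (Suc p)}" (is "?A = ?B")
    proof (rule set_eqI)
      fix i show "i \<in> ?A \<longleftrightarrow> i \<in> ?B"
        using b partner_eq_iff[of i p] partner_eq_iff[of i "Suc p"] l assms partner_less[of "Suc p"]
        by (cases "i < length d") (auto simp: Suc_le_eq le_less)
    qed
    then show ?thesis using b mv by (simp add: pending_def)
  next
    case c
    have "in_play (clean d p) = in_play (clean d (Suc (Suc p)))" (is "?A = ?B")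
    proof (rule set_eqI)
      fix i show "i \<in> ?A \<longleftrightarrow> i \<in> ?B"
        using c partner_eq_iff[of i p] partner_eq_iff[of i "Suc p"] l assms partner_less[of "Suc p"]
        by (cases "i < length d"; cases "i = p"; cases "i = Suc p") auto
    qed
    then show ?thesis using c mv by simp
  qed
qed

text \<open>Every known card other than these two has its mate beyond \<open>r\<close>, so the
  pending pair is the only known pair. Removing it turns up no unknown card, hence the move is not
  lucky.\<close>

lemma move_pending:
  assumes "r < length d" "partner d r < r"
  shows "move d (pending d r) = clean d (Suc r)" "\<not> lucky d (pending d r)"
proof -
  let ?a = "partner d r"
  have k: "known (pending d r) = {i. i < Suc r \<and> Suc r \<le> partner d i} \<union> {r, ?a}"
    using assms by (auto simp: known_def)
  have m: "mates d i j \<longleftrightarrow> (i = r \<and> j = ?a) \<or> (i = ?a \<and> j = r)"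
    if "i \<in> known (pending d r)" "j \<in> known (pending d r)" for i j
    using that mates_iff[of i j] assms partner_partner[of r] unfolding k by auto
  have ka: "?a \<in> known (pending d r)" "r \<in> known (pending d r)" by (auto simp: k)
  have "{i \<in> known (pending d r). \<exists>j\<in>known (pending d r). mates d i j} = {?a, r}"
    using m ka by blast
  moreover have "known_pair d (pending d r)"
    using m ka unfolding known_pair_def by blast
  ultimately have f: "first_card d (pending d r) = ?a"
    using assms by (simp add: first_card_def)
  have "j \<in> known (pending d r) \<and> mates d ?a j \<longleftrightarrow> j = r" for j
    using m ka assms by auto
  then have s: "second_card d (pending d r) = r"
    unfolding second_card_def f Let_def by auto
  have mm: "mates d ?a r" using m ka by blast
  have "(in_play (clean d (Suc r)) \<union> {r, ?a}) - {?a, r} = in_play (clean d (Suc r))"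
    using assms partner_partner[of r] by auto
  moreover have "{..<Suc r} \<union> {?a, r} = {..<Suc r}" using assms by auto
  ultimately show "move d (pending d r) = clean d (Suc r)"
    using mm unfolding move_def f s Let_def by simp
  show "\<not> lucky d (pending d r)"
    using assms unfolding lucky_def f s Let_def by simp
qed

text \<open>From \<open>clean d p\<close> the game reaches \<open>clean d (Suc p)\<close> if the
  mate of \<open>p\<close> is known, and otherwise, possibly through a pending state,
  \<open>clean d (Suc (Suc p))\<close>. The recursion of \<open>turn\<close> makes the same jumps,
  so both counts change alike.\<close>

lemma lucky_times_clean:
  assumes "p \<le> length d" "turn d p"
  shows "finite (lucky_times d (clean d p)) \<and>
    card (lucky_times d (clean d p)) = card (lucky_positions d p)"
  using assms
proof (induction "length d - p" arbitrary: p rule: less_induct)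
  case less
  show ?case
  proof (cases "p < length d")
    case False
    have "in_play (clean d p) = {}" using False partner_less
      by (auto simp: set_eq_iff) (meson le_trans leD not_le)+
    moreover have "lucky_positions d p = {}" using False by (auto simp: lucky_positions_def)
    ultimately show ?thesis by (simp add: lucky_times_finished)
  next
    case True
    show ?thesis
    proof (cases "partner d p < p")
      case pk: True
      have IH: "finite (lucky_times d (clean d (Suc p))) \<and>
          card (lucky_times d (clean d (Suc p))) = card (lucky_positions d (Suc p))"
        using less.hyps[of "Suc p"] less.prems True pk by simp
      \<comment> \<open>The mate of \<open>p\<close> lies to its left, so it is not
        \<open>Suc p\<close> and \<open>p\<close> contributes nothing.\<close>
      have "lucky_positions d p = lucky_positions d (Suc p)"
        using pk True mates_iff[of p "Suc p"]
        by (auto simp: lucky_positions_def Suc_le_eq le_less)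
      then show ?thesis
        using IH card_lucky_times_step[of d "clean d p"] move_clean_known[OF True pk] by simp
    next
      case False
      then have pu: "p < partner d p" using partner_neq[OF True] by simp
      have l: "Suc p < length d" using pu partner_less[OF True] by simp
      have IH: "finite (lucky_times d (clean d (Suc (Suc p)))) \<and>
          card (lucky_times d (clean d (Suc (Suc p)))) = card (lucky_positions d (Suc (Suc p)))"
        using less.hyps[of "Suc (Suc p)"] less.prems l pu by simp
      \<comment> \<open>A pending pair costs one additional move, which is not lucky.\<close>
      have nx: "finite (lucky_times d (move d (clean d p))) \<and>
          card (lucky_times d (move d (clean d p))) = card (lucky_positions d (Suc (Suc p)))"
      proof (cases "partner d (Suc p) < p")
        case True
        then have "partner d (Suc p) < Suc p" by simp
        then show ?thesis
          using True IH card_lucky_times_step[of d "pending d (Suc p)"] move_pending[OF l]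
            move_clean_unknown[OF \<open>p < length d\<close> pu] by simp
      next
        case False
        then show ?thesis using IH move_clean_unknown[OF \<open>p < length d\<close> pu] by simp
      qed
      \<comment> \<open>\<open>Suc p\<close> is used up as a second card, so the two sets can differ
        only in \<open>p\<close>.\<close>
      have "\<not> turn d (Suc p)" using less.prems pu by simp
      then have "lucky_positions d p =
          (if mates d p (Suc p) then {p} else {}) \<union> lucky_positions d (Suc (Suc p))"
        using l less.prems 
        by (auto simp: lucky_positions_def Suc_le_eq le_less simp del: turn.simps dest: Suc_lessI)
      moreover have "p \<notin> lucky_positions d (Suc (Suc p))" by (simp add: lucky_positions_def)
      ultimately have "card (lucky_positions d p) =
          (if mates d p (Suc p) then 1 else 0) + card (lucky_positions d (Suc (Suc p)))"
        using finite_lucky_positions by simp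
      then show ?thesis
        using nx card_lucky_times_step[of d "clean d p"] in_play_clean[OF True]
          lucky_clean_iff[OF True pu] by simp
    qed
  qed
qed

lemma lucky_moves_eq: "lucky_moves d = card (lucky_positions d 0)"
proof -
  have "start d = clean d 0" by (auto simp: start_def clean_def)
  then show ?thesis
    using lucky_times_clean[of 0] by (simp add: lucky_moves_def lucky_times_def game_after_def)
qed

section \<open>Turns as alternating sums over blocks\<close>

text \<open>\<open>turn d p\<close> fails iff the maximal run of cards ending just before \<open>p\<close> and having a later
  mate is of odd length.\<close>

lemma turn_alternating_sum:
  "p \<le> length d \<Longrightarrow> of_bool (turn d p) =
    (\<Sum>j\<le>p. (-1) ^ j * of_bool (\<forall>i\<in>{p-j..<p}. i < partner d i) :: real)"
proof (induction p)
  case (Suc p)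
  have "(\<Sum>j\<le>Suc p. (-1) ^ j * of_bool (\<forall>i\<in>{Suc p-j..<Suc p}. i < partner d i) :: real) =
     1 + (\<Sum>j\<le>p. (-1) ^ Suc j * of_bool (\<forall>i\<in>{p-j..<Suc p}. i < partner d i))"
    by (subst sum.atMost_Suc_shift) simp
  \<comment> \<open>After the term for \<open>j = 0\<close> is split off, every block contains
    \<open>p\<close>. Its condition factors out and leaves the sum for \<open>p\<close>, matching
    \<open>turn d (Suc p)\<close> = 1 - [\<open>p < partner d p\<close>] *
    \<open>turn d p\<close>.\<close>
  also have "(\<Sum>j\<le>p. (-1) ^ Suc j * of_bool (\<forall>i\<in>{p-j..<Suc p}. i < partner d i) :: real) =
    (\<Sum>j\<le>p. - (of_bool (p < partner d p) * ((-1) ^ j * of_bool (\<forall>i\<in>{p-j..<p}. i < partner d i))))"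
    by (rule sum.cong) (auto simp: less_Suc_eq)
  also have "\<dots> = - (of_bool (p < partner d p) * of_bool (turn d p))"
    using Suc by (simp add: sum_negf sum_distrib_left)
  finally show ?case by auto
qed simp

text \<open>Two cards of the block that both have later mates cannot be mates of each other, and
  \<open>p\<close>, \<open>Suc p\<close> are taken by one another, so the mates lie beyond. This
  makes the block disjoint from the set of possible mates, as \<open>card_block_mates\<close>
  requires.\<close>

lemma block_before_lucky_pair_iff:
  assumes "Suc p < length d" "mates d p (Suc p)"
  shows "(\<forall>i\<in>{p-j..<p}. i < partner d i) \<longleftrightarrow>
    (\<forall>i\<in>{p-j..<p}. \<exists>c\<in>{Suc (Suc p)..<length d}. mates d i c)"
proof (intro iffI ballI)
  fix i assume A: "\<forall>i\<in>{p-j..<p}. i < partner d i" and i: "i \<in> {p-j..<p}"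
  have il: "i < length d" using i assms by simp
  have "partner d i \<notin> {p-j..<p}"
  proof
    assume "partner d i \<in> {p-j..<p}"
    then have "partner d i < partner d (partner d i)" using A by blast
    moreover have "i < partner d i" using A i by blast
    ultimately show False using partner_partner[OF il] by simp
  qed
  moreover have "i < partner d i" using A i by blast
  moreover have "partner d i \<noteq> p" "partner d i \<noteq> Suc p"
    using assms mates_iff[of p "Suc p"] partner_partner[OF il] partner_partner[of p] i by auto
  ultimately have "Suc (Suc p) \<le> partner d i" using i by auto
  then show "\<exists>c\<in>{Suc (Suc p)..<length d}. mates d i c"
    using partner[OF il] by auto
next
  fix i assume A: "\<forall>i\<in>{p-j..<p}. \<exists>c\<in>{Suc (Suc p)..<length d}. mates d i c" and i: "i \<in> {p-j..<p}"
  then obtain c where "c\<in>{Suc (Suc p)..<length d}" "mates d i c" by blast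
  then show "i < partner d i" using i mates_iff[of i c] by auto
qed

end

section \<open>Counting decks by exchangeability\<close>

text \<open>Conditioning on the pairs occupying the positions in \<^term>\<open>U\<close> leaves a set of decks that
  is still invariant under swapping the remaining cards.\<close>

definition exchangeable :: "nat \<Rightarrow> nat list set \<Rightarrow> nat set \<Rightarrow> bool" where
  "exchangeable n X U \<longleftrightarrow> X \<subseteq> decks n \<and> U \<subseteq> {..<2 * n} \<and>
    (\<forall>d\<in>X. \<forall>i\<in>U. \<exists>j\<in>U. mates d i j) \<and>
    (\<forall>d\<in>X. \<forall>i\<in>{..<2 * n} - U. \<forall>j\<in>{..<2 * n} - U. d[i := d ! j, j := d ! i] \<in> X)"

lemma finite_decks [simp]: "finite (decks n)"
  by (simp add: decks_def)

lemma decks_nonempty: "decks n \<noteq> {}"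
  by (simp add: decks_def permutations_of_multiset_not_empty)

lemma mset_list_swap: "i < length xs \<Longrightarrow> j < length xs \<Longrightarrow> mset (xs[i := xs ! j, j := xs ! i]) = mset xs"
  using mset_swap[of j xs i] by simp

lemma exchangeable_decks: "exchangeable n (decks n) {}"
  by (auto simp: exchangeable_def mset_list_swap length_deck) (simp add: decks_iff mset_list_swap length_deck)

lemma mates_swap:
  assumes "i < length d" "j < length d" "a < length d" "b < length d"
  shows "mates (d[i := d ! j, j := d ! i]) a b \<longleftrightarrow>
    mates d (Transposition.transpose i j a) (Transposition.transpose i j b)"
  using assms by (auto simp: mates_def nth_list_update transpose_def)

lemma mates_unique:
  assumes "d \<in> decks n" "mates d b c" "mates d b c'" "b < 2 * n" "c < 2 * n" "c' < 2 * n"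
  shows "c = c'"
  using ex1_mate[OF assms(1), of b] assms by (auto simp: length_deck)

text \<open>Swapping the cards at \<open>c\<close> and \<open>c'\<close> is an involution of
  \<open>X\<close> that fixes \<open>b\<close> and exchanges the two events.\<close>

lemma card_mates_eq:
  assumes X: "exchangeable n X U" and "b \<in> {..<2*n} - U" "c \<in> {..<2*n} - U" "c' \<in> {..<2*n} - U"
    and "b \<noteq> c" "b \<noteq> c'"
  shows "card {d\<in>X. mates d b c} = card {d\<in>X. mates d b c'}"
proof -
  let ?s = "\<lambda>d. d[c := d ! c', c' := d ! c] :: nat list"
  have len: "length d = 2 * n" if "d \<in> X" for d
    using that X by (auto simp: exchangeable_def length_deck)
  have inX: "?s d \<in> X" if "d \<in> X" for d
    using that X assms by (auto simp: exchangeable_def)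
  have "?s (?s d) = d" if "d \<in> X" for d
    using assms len[OF that] by (intro nth_equalityI) (auto simp: nth_list_update)
  moreover have "mates (?s d) b c' \<longleftrightarrow> mates d b c" "mates (?s d) b c \<longleftrightarrow> mates d b c'"
    if "d \<in> X" for d
    using assms len[OF that] by (auto simp: mates_swap transpose_def)
  ultimately have "bij_betw ?s {d\<in>X. mates d b c} {d\<in>X. mates d b c'}"
    using inX by (intro bij_betwI[of _ _ _ ?s]) auto
  then show ?thesis by (rule bij_betw_same_card)
qed

lemma finite_exchangeable: "exchangeable n X U \<Longrightarrow> finite X"
  unfolding exchangeable_def by (metis finite_decks finite_subset)

text \<open>The positions in \<open>U\<close> are paired among themselves, so the mate of
  \<open>b\<close> lies in \<open>?V\<close>. The events for its different positions are disjoint,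
  cover \<open>X\<close> and are equally frequent by \<open>card_mates_eq\<close>.\<close>

lemma card_mates:
  assumes X: "exchangeable n X U" and b: "b \<in> {..<2*n} - U" and c: "c \<in> {..<2*n} - U" and "b \<noteq> c"
  shows "real (card {d\<in>X. mates d b c}) = real (card X) / real (2 * n - 1 - card U)"
proof -
  let ?V = "{..<2*n} - U - {b}"
  have XD: "X \<subseteq> decks n" and U: "U \<subseteq> {..<2*n}"
    and UU: "\<And>d i. d \<in> X \<Longrightarrow> i \<in> U \<Longrightarrow> \<exists>j\<in>U. mates d i j"
    using X by (auto simp: exchangeable_def)
  have "card ?V = 2 * n - card U - 1"
    using b U by (simp add: card_Diff_subset finite_subset)
  then have V: "card ?V = 2 * n - 1 - card U" by simp
  have "?V \<noteq> {}" using c \<open>b \<noteq> c\<close> by blast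
  then have pos: "card ?V > 0" by (simp add: card_gt_0_iff)
  have "X \<subseteq> (\<Union>c'\<in>?V. {d\<in>X. mates d b c'})"
  proof
    fix d assume d: "d \<in> X"
    then have dd: "d \<in> decks n" using XD by blast
    then obtain j where j: "j < 2 * n" "mates d b j"
      using ex1_mate[OF dd, of b] b by (auto simp: length_deck)
    have "j \<notin> U"
    proof
      assume "j \<in> U"
      then obtain i where "i \<in> U" "mates d j i" using UU d by blast
      then show False using mates_unique[OF dd, of j i b] U j b mates_sym[of d b j] by auto
    qed
    moreover have "j \<noteq> b" using j by (auto simp: mates_def)
    ultimately show "d \<in> (\<Union>c'\<in>?V. {d\<in>X. mates d b c'})" using d j by auto
  qed
  then have "X = (\<Union>c'\<in>?V. {d\<in>X. mates d b c'})" by blast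
  then have "card X = card (\<Union>c'\<in>?V. {d\<in>X. mates d b c'})" by simp
  also have "\<dots> = (\<Sum>c'\<in>?V. card {d\<in>X. mates d b c'})"
  proof (rule card_UN_disjoint)
    show "\<forall>i\<in>?V. \<forall>j\<in>?V. i \<noteq> j \<longrightarrow> {d \<in> X. mates d b i} \<inter> {d \<in> X. mates d b j} = {}"
      using mates_unique[of _ n b] XD b by blast
  qed (use finite_exchangeable[OF X] in auto)
  also have "\<dots> = (\<Sum>c'\<in>?V. card {d\<in>X. mates d b c})"
    using assms by (intro sum.cong card_mates_eq[OF X]) auto
  finally have "card X = (2 * n - 1 - card U) * card {d\<in>X. mates d b c}"
    by (simp add: V)
  then show ?thesis using pos unfolding V by (simp add: field_simps)
qed

lemma exchangeable_mates:
  assumes X: "exchangeable n X U" and b: "b \<in> {..<2*n} - U" and c: "c \<in> {..<2*n} - U"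
  shows "exchangeable n {d\<in>X. mates d b c} (U \<union> {b, c})"
proof -
  have "mates (d[i := d ! j, j := d ! i]) b c"
    if "d \<in> X" "mates d b c" "i \<in> {..<2 * n} - (U \<union> {b, c})" "j \<in> {..<2 * n} - (U \<union> {b, c})"
    for d i j
    using that b c by (auto simp: mates_def)
  then show ?thesis
    using assms mates_sym unfolding exchangeable_def by blast
qed

text \<open>The cards of \<open>B\<close> choose mates one after another: each choice takes one
  position from \<open>Q\<close> and adds two to \<open>U\<close>. If \<open>Q\<close> is too small,
  a truncated numerator makes the product 0.\<close>

lemma card_block_mates:
  assumes "exchangeable n X U" "finite B" "B \<subseteq> {..<2*n} - U" "Q \<subseteq> {..<2*n} - U" "B \<inter> Q = {}"
  shows "real (card {d\<in>X. \<forall>b\<in>B. \<exists>c\<in>Q. mates d b c}) =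
    real (card X) * (\<Prod>i<card B. real (card Q - i) / real (2 * n - 1 - card U - 2 * i))"
  using assms(2,1,3-)
proof (induction B arbitrary: X U Q rule: finite_induct)
  case (insert b B)
  note X = insert.prems(1)
  have XD: "X \<subseteq> decks n" and U: "U \<subseteq> {..<2*n}"
    using X by (auto simp: exchangeable_def)
  have b: "b \<in> {..<2*n} - U" using insert.prems by blast
  have finQ: "finite Q" using insert.prems(3) finite_subset by blast
  \<comment> \<open>The remaining factors after \<open>b\<close> has chosen \<open>c\<close>: both
    changes, to \<open>card Q\<close> and to \<open>card U\<close>, amount to shifting the index by
    one.\<close>
  define f where "f = (\<lambda>i. real (card Q - Suc i) / real (2 * n - 1 - card U - 2 * Suc i))"
  let ?X = "\<lambda>c. {d\<in>X. mates d b c}"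
  let ?Y = "\<lambda>c. {d \<in> ?X c. \<forall>b\<in>B. \<exists>c'\<in>Q - {c}. mates d b c'}"
  have "{d\<in>X. \<forall>b\<in>insert b B. \<exists>c\<in>Q. mates d b c} = (\<Union>c\<in>Q. ?Y c)"
  proof (intro subset_antisym subsetI)
    fix d assume d: "d \<in> {d\<in>X. \<forall>b\<in>insert b B. \<exists>c\<in>Q. mates d b c}"
    then obtain c where c: "c \<in> Q" "mates d b c" by blast
    have "\<exists>c'\<in>Q - {c}. mates d b' c'" if b': "b' \<in> B" for b'
    proof -
      obtain c' where c': "c' \<in> Q" "mates d b' c'" using d b' by blast
      have "c' \<noteq> c"
      proof
        assume "c' = c"
        then have "b = b'" using mates_unique[of d n c b b'] c c' d b b' XD insert.prems mates_sym
          by blast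
        then show False using b' insert.hyps by blast
      qed
      then show ?thesis using c' by blast
    qed
    then show "d \<in> (\<Union>c\<in>Q. ?Y c)" using c d by blast
  qed blast
  then have "card {d\<in>X. \<forall>b\<in>insert b B. \<exists>c\<in>Q. mates d b c} = card (\<Union>c\<in>Q. ?Y c)" by simp
  also have "\<dots> = (\<Sum>c\<in>Q. card (?Y c))"
  proof (rule card_UN_disjoint)
    show "\<forall>i\<in>Q. \<forall>j\<in>Q. i \<noteq> j \<longrightarrow> ?Y i \<inter> ?Y j = {}"
      using mates_unique[of _ n b] XD b insert.prems(3) by blast
  qed (use finite_exchangeable[OF X] finQ in auto)
  finally have "real (card {d\<in>X. \<forall>b\<in>insert b B. \<exists>c\<in>Q. mates d b c}) =
      (\<Sum>c\<in>Q. real (card (?Y c)))" by simp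
  also have "\<dots> = (\<Sum>c\<in>Q. real (card X) / real (2 * n - 1 - card U) * (\<Prod>i<card B. f i))"
  proof (rule sum.cong)
    fix c assume c: "c \<in> Q"
    then have cU: "c \<in> {..<2*n} - U" and "b \<noteq> c" using insert.prems by auto
    have "card (U \<union> {b, c}) = card U + 2"
      using b cU \<open>b \<noteq> c\<close> U finite_subset[OF U] by simp
    moreover have "real (card (?Y c)) = real (card (?X c)) *
        (\<Prod>i<card B. real (card (Q - {c}) - i) / real (2 * n - 1 - card (U \<union> {b, c}) - 2 * i))"
      using insert.prems insert.hyps c by (intro insert.IH exchangeable_mates[OF X b cU]) auto
    ultimately have "real (card (?Y c)) = real (card (?X c)) * (\<Prod>i<card B. f i)"
      using c finQ by (simp add: f_def)
    then show "real (card (?Y c)) = real (card X) / real (2 * n - 1 - card U) * (\<Prod>i<card B. f i)"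
      using card_mates[OF X b cU \<open>b \<noteq> c\<close>] by simp
  qed simp
  also have "\<dots> = real (card X) * (\<Prod>i<Suc (card B). real (card Q - i) / real (2 * n - 1 - card U - 2 * i))"
    by (subst prod.lessThan_Suc_shift) (simp add: f_def)
  finally show ?case using insert.hyps by simp
qed simp

section \<open>The expectation as an alternating sum\<close>

lemma lucky_moves_alternating_sum:
  assumes d: "d \<in> decks n"
  shows "real (lucky_moves d) = (\<Sum>p<2*n-1. \<Sum>j\<le>p. (-1) ^ j *
    of_bool (mates d p (Suc p) \<and> (\<forall>i\<in>{p-j..<p}. \<exists>c\<in>{Suc (Suc p)..<2*n}. mates d i c)))"
proof -
  have len: "length d = 2 * n" using d by (rule length_deck)
  have "lucky_positions d 0 = {..<2*n-1} \<inter> {p. mates d p (Suc p) \<and> turn d p}"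
    by (auto simp: lucky_positions_def len)
  then have "real (lucky_moves d) = (\<Sum>p<2*n-1. of_bool (mates d p (Suc p) \<and> turn d p))"
    by (simp add: lucky_moves_eq[OF d] sum_of_bool_eq)
  also have "\<dots> = (\<Sum>p<2*n-1. \<Sum>j\<le>p. (-1) ^ j *
    of_bool (mates d p (Suc p) \<and> (\<forall>i\<in>{p-j..<p}. \<exists>c\<in>{Suc (Suc p)..<2*n}. mates d i c)))"
  proof (rule sum.cong)
    fix p assume p: "p \<in> {..<2*n-1}"
    show "of_bool (mates d p (Suc p) \<and> turn d p) = (\<Sum>j\<le>p. (-1) ^ j *
      of_bool (mates d p (Suc p) \<and>
        (\<forall>i\<in>{p-j..<p}. \<exists>c\<in>{Suc (Suc p)..<2*n}. mates d i c)) :: real)"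
    proof (cases "mates d p (Suc p)")
      case True
      then show ?thesis
        using p turn_alternating_sum[OF d, of p] block_before_lucky_pair_iff[OF d _ True]
        by (simp add: len)
    qed simp
  qed simp
  finally show ?thesis .
qed

text \<open>Pairing \<open>p\<close> with \<open>Suc p\<close> gives the denominator
  \<open>2 * n - 1\<close>, the factor for \<open>i = 0\<close>. The \<open>j\<close> cards of the
  block then choose among the \<open>2 * n - 2 - p\<close> positions right of the pair.\<close>

lemma card_lucky_block:
  assumes "Suc p < 2 * n" "j \<le> p"
  shows "real (card {d \<in> decks n. mates d p (Suc p) \<and>
      (\<forall>i\<in>{p-j..<p}. \<exists>c\<in>{Suc (Suc p)..<2*n}. mates d i c)}) =
    real (card (decks n)) *
      ((\<Prod>i<j. real (2 * n - 2 - p - i)) / (\<Prod>i\<le>j. real (2 * n - 1 - 2 * i)))"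
proof -
  let ?X = "{d \<in> decks n. mates d p (Suc p)}"
  have X: "exchangeable n ?X {p, Suc p}"
    using exchangeable_mates[OF exchangeable_decks, of p n "Suc p"] assms by simp
  have "{d \<in> decks n. mates d p (Suc p) \<and>
      (\<forall>i\<in>{p-j..<p}. \<exists>c\<in>{Suc (Suc p)..<2*n}. mates d i c)} =
      {d \<in> ?X. \<forall>i\<in>{p-j..<p}. \<exists>c\<in>{Suc (Suc p)..<2*n}. mates d i c}" by blast
  moreover have "{p-j..<p} \<subseteq> {..<2*n} - {p, Suc p}" "{Suc (Suc p)..<2*n} \<subseteq> {..<2*n} - {p, Suc p}"
    using assms by auto
  moreover have "(\<Prod>i\<le>j. real (2 * n - 1 - 2 * i)) =
      real (2 * n - 1) * (\<Prod>i<j. real (2 * n - 1 - 2 - 2 * i))"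
    unfolding lessThan_Suc_atMost[symmetric] prod.lessThan_Suc_shift by simp
  ultimately show ?thesis
    using card_block_mates[OF X, of "{p-j..<p}" "{Suc (Suc p)..<2*n}"]
      card_mates[OF exchangeable_decks, of p n "Suc p"] assms
    by (simp add: prod_dividef)
qed

text \<open>The hockey-stick identity for falling factorials; truncated subtraction makes them
  vanish for \<open>q < j\<close>.\<close>

lemma sum_prod_falling:
  "(\<Sum>q<N. \<Prod>i<j. real (q - i)) = (\<Prod>i\<le>j. real (N - i)) / real (Suc j)"
proof (induction N)
  case 0
  have "(\<Prod>i\<le>j. real (0 - i)) = 0" by (rule prod_zero) auto
  then show ?case by simp
next
  case (Suc N)
  have "(\<Prod>i\<le>j. real (Suc N - i)) = real (Suc N) * (\<Prod>i<j. real (N - i))"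
    unfolding lessThan_Suc_atMost[symmetric] prod.lessThan_Suc_shift by simp
  moreover have "(\<Prod>i\<le>j. real (N - i)) = real (N - j) * (\<Prod>i<j. real (N - i))"
    by (simp flip: lessThan_Suc_atMost)
  \<comment> \<open>For \<open>N < j\<close> the truncated \<open>N - j\<close> differs from the
    real difference, but the product then contains the zero factor \<open>i = N\<close>.\<close>
  moreover have "(\<Prod>i<j. real (N - i)) = 0" if "N < j"
    using that by (intro prod_zero) auto
  then have "real (N - j) * (\<Prod>i<j. real (N - i)) = (real N - real j) * (\<Prod>i<j. real (N - i))"
    by (cases "N < j") (auto simp: of_nat_diff)
  ultimately show ?case using Suc by (simp add: field_simps)
qed

text \<open>The expected number of positions \<open>p \<ge> j\<close> such that \<open>p\<close> and
  \<open>Suc p\<close> are mates and the \<open>j\<close> cards before \<open>p\<close> all have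
  mates further right, with \<open>p\<close> summed out by \<open>sum_prod_falling\<close>.\<close>

definition run_weight :: "nat \<Rightarrow> nat \<Rightarrow> real" where
  "run_weight n j = (\<Prod>i\<le>j. real (2 * n - 1 - j - i) / real (2 * n - 1 - 2 * i)) / real (Suc j)"

lemma expected_lucky_moves_eq:
  "expected_lucky_moves n = (\<Sum>j<2*n-1. (-1) ^ j * run_weight n j)"
proof -
  let ?P = "\<lambda>d p j. mates d p (Suc p) \<and>
      (\<forall>i\<in>{p-j..<p}. \<exists>c\<in>{Suc (Suc p)..<2*n}. mates d i c)"
  let ?c = "real (card (decks n))"
  let ?h = "\<lambda>p j. (\<Prod>i<j. real (2 * n - 2 - p - i)) / (\<Prod>i\<le>j. real (2 * n - 1 - 2 * i))"
  have c: "?c > 0" using decks_nonempty by (simp add: card_gt_0_iff)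
  have "expected_lucky_moves n = (\<Sum>d\<in>decks n. real (lucky_moves d)) / ?c"
    unfolding expected_lucky_moves_def by (rule integral_pmf_of_set) (auto simp: decks_nonempty)
  also have "(\<Sum>d\<in>decks n. real (lucky_moves d)) =
      (\<Sum>d\<in>decks n. \<Sum>p<2*n-1. \<Sum>j\<le>p. (-1) ^ j * of_bool (?P d p j))"
    by (intro sum.cong lucky_moves_alternating_sum refl)
  also have "\<dots> = (\<Sum>p<2*n-1. \<Sum>d\<in>decks n. \<Sum>j\<le>p. (-1) ^ j * of_bool (?P d p j))"
    by (rule sum.swap)
  also have "\<dots> = (\<Sum>p<2*n-1. \<Sum>j\<le>p. \<Sum>d\<in>decks n. (-1) ^ j * of_bool (?P d p j))"
    by (intro sum.cong sum.swap refl)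
  also have "\<dots> = (\<Sum>p<2*n-1. \<Sum>j\<le>p. (-1) ^ j * real (card {d \<in> decks n. ?P d p j}))"
    by (simp add: sum_of_bool_eq Int_def flip: sum_distrib_left)
  also have "\<dots> = (\<Sum>p<2*n-1. \<Sum>j\<le>p. (-1) ^ j * (?c * ?h p j))"
    by (intro sum.cong refl) (subst card_lucky_block, auto)
  also have "\<dots> = ?c * (\<Sum>p<2*n-1. \<Sum>j\<le>p. (-1) ^ j * ?h p j)"
    by (simp add: sum_distrib_left mult_ac)
  also have "(\<Sum>p<2*n-1. \<Sum>j\<le>p. (-1) ^ j * ?h p j) =
      (\<Sum>j<2*n-1. \<Sum>p\<in>{j..<2*n-1}. (-1) ^ j * ?h p j)"
  proof -
    have "(\<Sum>p<2*n-1. \<Sum>j\<le>p. (-1) ^ j * ?h p j) =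
        (\<Sum>p<2*n-1. \<Sum>j\<in>{j\<in>{..<2*n-1}. j \<le> p}. (-1) ^ j * ?h p j)"
      by (intro sum.cong) auto
    also have "\<dots> = (\<Sum>j<2*n-1. \<Sum>p\<in>{p\<in>{..<2*n-1}. j \<le> p}. (-1) ^ j * ?h p j)"
      by (rule sum.swap_restrict) auto
    also have "\<dots> = (\<Sum>j<2*n-1. \<Sum>p\<in>{j..<2*n-1}. (-1) ^ j * ?h p j)"
      by (intro sum.cong) auto
    finally show ?thesis .
  qed
  also have "\<dots> = (\<Sum>j<2*n-1. (-1) ^ j * run_weight n j)"
  proof (rule sum.cong)
    fix j assume j: "j \<in> {..<2*n-1}"
    \<comment> \<open>The new variable \<open>q = 2 * n - 2 - p\<close> counts the cards to the
      right of the pair \<open>p\<close>, \<open>Suc p\<close>.\<close>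
    have "(\<Sum>p\<in>{j..<2*n-1}. \<Prod>i<j. real (2 * n - 2 - p - i)) =
        (\<Sum>q<2*n-1-j. \<Prod>i<j. real (q - i))"
      by (rule sum.reindex_bij_witness[of _ "\<lambda>q. 2*n-2-q" "\<lambda>p. 2*n-2-p"]) auto
    then show "(\<Sum>p\<in>{j..<2*n-1}. (-1) ^ j * ?h p j) = (-1) ^ j * run_weight n j"
      by (simp add: run_weight_def sum_prod_falling prod_dividef
          flip: sum_distrib_left sum_divide_distrib)
  qed simp
  finally show ?thesis using c decks_nonempty by simp
qed

section \<open>Monotonicity and limits of the weights\<close>

lemma run_weight_nonneg: "0 \<le> run_weight n j"
  unfolding run_weight_def by (intro divide_nonneg_nonneg prod_nonneg) auto

text \<open>The numerator for \<open>i = j\<close> is truncated to 0.\<close>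

lemma run_weight_eq_0:
  assumes "n \<le> j"
  shows "run_weight n j = 0"
proof -
  have "(\<Prod>i\<le>j. real (2 * n - 1 - j - i) / real (2 * n - 1 - 2 * i)) = 0"
    by (rule prod_zero) (use assms in \<open>auto intro!: bexI[of _ j]\<close>)
  then show ?thesis by (simp add: run_weight_def)
qed

lemma run_weight_Suc_le: "run_weight n (Suc j) \<le> run_weight n j"
proof -
  let ?f = "\<lambda>j i. real (2 * n - 1 - j - i) / real (2 * n - 1 - 2 * i)"
  have "(\<Prod>i\<le>Suc j. ?f (Suc j) i) = (\<Prod>i\<le>j. ?f (Suc j) i) * ?f (Suc j) (Suc j)" by simp
  \<comment> \<open>The last factor has equal numerator and denominator, so it is 1, or 0 when both
    are truncated to 0.\<close>
  also have "\<dots> \<le> (\<Prod>i\<le>j. ?f (Suc j) i) * 1"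
    by (intro mult_left_mono prod_nonneg) (auto simp: divide_le_eq_1 simp flip: mult_2)
  also have "\<dots> \<le> (\<Prod>i\<le>j. ?f j i)"
    by (simp only: mult_1_right, intro prod_mono conjI divide_right_mono) auto
  finally show ?thesis
    unfolding run_weight_def by (intro frac_le prod_nonneg) auto
qed

text \<open>For fixed \<open>j\<close> the number of factors is fixed and each tends to 1; from
  \<open>n \<ge> 1 + i + j\<close> on no subtraction is truncated.\<close>

lemma run_weight_tendsto: "(\<lambda>n. run_weight n j) \<longlonglongrightarrow> 1 / real (Suc j)"
proof -
  have "(\<lambda>n. real (2 * n - 1 - j - i) / real (2 * n - 1 - 2 * i)) \<longlonglongrightarrow> 1" for i
  proof (rule Lim_transform_eventually)
    show "(\<lambda>n. (2 * real n - (1 + real j + real i)) / (2 * real n - (1 + 2 * real i))) \<longlonglongrightarrow> 1"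
      by real_asymp
    show "\<forall>\<^sub>F n in sequentially.
        (2 * real n - (1 + real j + real i)) / (2 * real n - (1 + 2 * real i)) =
        real (2 * n - 1 - j - i) / real (2 * n - 1 - 2 * i)"
      using eventually_ge_at_top[of "1 + i + j"] by eventually_elim (simp add: of_nat_diff)
  qed
  then have "(\<lambda>n. run_weight n j) \<longlonglongrightarrow> (\<Prod>i\<le>j. 1) / real (Suc j)"
    unfolding run_weight_def by (intro tendsto_intros) auto
  then show ?thesis by simp
qed

section \<open>Leibniz bounds and passage to the limit\<close>

lemma expected_lucky_moves_bounds:
  assumes "n \<ge> 1"
  shows "(\<Sum>j<2*k. (-1) ^ j * run_weight n j) \<le> expected_lucky_moves n"
    and "expected_lucky_moves n \<le> (\<Sum>j<2*k+1. (-1) ^ j * run_weight n j)"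
proof -
  have "run_weight n \<longlonglongrightarrow> 0"
    by (rule tendsto_eventually) (use eventually_ge_at_top[of n] in eventually_elim, rule run_weight_eq_0)
  note Leibniz = summable_Leibniz'(2,4)[OF this run_weight_nonneg run_weight_Suc_le]
  \<comment> \<open>The series terminates: \<open>n \<ge> 1\<close> gives
    \<open>2 * n - 1 \<ge> n\<close>, and the weights vanish from index \<open>n\<close> on.\<close>
  have "(\<Sum>j. (-1) ^ j * run_weight n j) = expected_lucky_moves n"
    unfolding expected_lucky_moves_eq
    by (rule suminf_finite) (use assms in \<open>auto simp: run_weight_eq_0\<close>)
  then show "(\<Sum>j<2*k. (-1) ^ j * run_weight n j) \<le> expected_lucky_moves n"
    and "expected_lucky_moves n \<le> (\<Sum>j<2*k+1. (-1) ^ j * run_weight n j)"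
    using Leibniz[of k] by simp_all
qed

theorem corollary18:
  shows "expected_lucky_moves \<longlonglongrightarrow> ln 2"
proof -
  have S: "(\<lambda>n. \<Sum>j<m. (-1) ^ j * run_weight n j) \<longlonglongrightarrow> (\<Sum>j<m. (-1) ^ j / real (Suc j))" for m
    using run_weight_tendsto by (auto intro!: tendsto_eq_intros)
  have L: "(\<lambda>m. \<Sum>j<m. (-1) ^ j / real (Suc j)) \<longlonglongrightarrow> ln 2"
    using alternating_harmonic_series_sums by (simp add: sums_def)
  have even: "filterlim (\<lambda>k::nat. 2 * k) sequentially sequentially"
    and odd: "filterlim (\<lambda>k::nat. 2 * k + 1) sequentially sequentially"
    by real_asymp+
  show ?thesis
  proof (rule order_tendstoI)
    fix a :: real assume "a < ln 2"
    \<comment> \<open>Fixing \<open>k\<close> before \<open>n\<close> leaves finitely many terms,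
      where termwise limits apply. Even truncations bound the expectation from below; odd ones serve
      for the upper bound.\<close>
    then obtain k where "a < (\<Sum>j<2*k. (-1) ^ j / real (Suc j))"
      using order_tendstoD(1)[OF filterlim_compose[OF L even]] eventually_happens' by force
    from order_tendstoD(1)[OF S this] eventually_ge_at_top[of 1]
    show "\<forall>\<^sub>F n in sequentially. a < expected_lucky_moves n"
      by eventually_elim (use expected_lucky_moves_bounds(1) less_le_trans in blast)
  next
    fix a :: real assume "ln 2 < a"
    then obtain k where "(\<Sum>j<2*k+1. (-1) ^ j / real (Suc j)) < a"
      using order_tendstoD(2)[OF filterlim_compose[OF L odd]] eventually_happens' by force
    from order_tendstoD(2)[OF S this] eventually_ge_at_top[of 1]
    show "\<forall>\<^sub>F n in sequentially. expected_lucky_moves n < a"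
      by eventually_elim (use expected_lucky_moves_bounds(2) le_less_trans in blast)
  qed
qed

end
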